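(* Let $n\ge 1$ and $d\ge 0$ be integers, and let $L=L(n,d)$ be a natural number such that for any normal topological space $T$ of finite covering dimension $d$, every null-homotopic continuous map $T\to SL_n(\mathbb{C})$ can be written as a product of no more than $L$ unitriangular matrices with entries in $\mathcal{C}(T)$. Then for any normal topological space $T$ of finite covering dimension $d$, every null-homotopic continuous map $f: T\to SL_n(\mathbb{C})$ can be written as a product of no more than $4\left(\lfloor L/2\rfloor+1\right)$ involutions with entries in $\mathcal{C}(T)$.
   Context: $\mathcal{C}(T)$ is the ring of continuous complex-valued functions on $T$; continuous maps $T\to SL_n(\mathbb{C})$ are identified with elements of $SL_n(\mathcal{C}(T))$. A unitriangular matrix is an upper or a lower triangular matrix with all diagonal entries equal to $1$. An involution with entries in $\mathcal{C}(T)$ is a matrix $B\in GL_n(\mathcal{C}(T))$ with $B^2=I$. Null-homotopic means homotopic to a constant map through continuous maps $T\to SL_n(\mathbb{C})$. A natural number $L(n,d)$ with the stated property exists for all $n$ and $d$ by a theorem of Vaserstein. *)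

theory Defs
  imports
    "HOL-Analysis.Homotopy"
    "HOL-Analysis.Abstract_Topological_Spaces"
    "HOL-Analysis.Function_Topology"
    "Jordan_Normal_Form.Determinant"
begin

section \<open>Covering dimension\<close>

text \<open>
  Covering dimension in the sense used for normal spaces, i.e. by means of finite open covers.
  A bound of \<open>-1\<close> holds precisely for the empty space.
\<close>

definition covering_dim_le :: "'a topology \<Rightarrow> int \<Rightarrow> bool" where
  "covering_dim_le X k \<longleftrightarrow>
     (\<forall>\<U>. finite \<U> \<and> (\<forall>U\<in>\<U>. openin X U) \<and> \<Union>\<U> = topspace X \<longrightarrow>
       (\<exists>\<V>. finite \<V> \<and> (\<forall>V\<in>\<V>. openin X V) \<and> \<Union>\<V> = topspace X \<and>
            (\<forall>V\<in>\<V>. \<exists>U\<in>\<U>. V \<subseteq> U) \<and>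
            (\<forall>x\<in>topspace X. int (card {V\<in>\<V>. x \<in> V}) \<le> k + 1)))"

definition has_covering_dim :: "'a topology \<Rightarrow> nat \<Rightarrow> bool" where
  "has_covering_dim X d \<longleftrightarrow> covering_dim_le X (int d) \<and> \<not> covering_dim_le X (int d - 1)"

lemma covering_dim_le_mono:
  assumes le: "covering_dim_le X k" and kl: "k \<le> l"
  shows "covering_dim_le X l"
  unfolding covering_dim_le_def
proof (intro allI impI)
  fix \<U> assume U: "finite \<U> \<and> (\<forall>U\<in>\<U>. openin X U) \<and> \<Union>\<U> = topspace X"
  obtain \<V> where "finite \<V>" "\<forall>V\<in>\<V>. openin X V" "\<Union>\<V> = topspace X"
      "\<forall>V\<in>\<V>. \<exists>U\<in>\<U>. V \<subseteq> U"
      and ord: "\<forall>x\<in>topspace X. int (card {V\<in>\<V>. x \<in> V}) \<le> k + 1"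
    using le[unfolded covering_dim_le_def, rule_format, OF U] by (elim exE conjE)
  moreover have "\<forall>x\<in>topspace X. int (card {V\<in>\<V>. x \<in> V}) \<le> l + 1"
  proof
    fix x assume "x \<in> topspace X"
    then show "int (card {V\<in>\<V>. x \<in> V}) \<le> l + 1"
      using bspec[OF ord, of x] kl by linarith
  qed
  ultimately show "\<exists>\<V>. finite \<V> \<and> (\<forall>V\<in>\<V>. openin X V) \<and> \<Union>\<V> = topspace X \<and>
      (\<forall>V\<in>\<V>. \<exists>U\<in>\<U>. V \<subseteq> U) \<and>
      (\<forall>x\<in>topspace X. int (card {V\<in>\<V>. x \<in> V}) \<le> l + 1)"
    by (intro exI[of _ \<V>] conjI)
qed

lemma covering_dim_le_minus_one_iff: "covering_dim_le X (- 1) \<longleftrightarrow> topspace X = {}"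
proof
  assume le: "covering_dim_le X (- 1)"
  have U: "finite {topspace X} \<and> (\<forall>U\<in>{topspace X}. openin X U) \<and> \<Union>{topspace X} = topspace X"
    by simp
  obtain \<V> where fin: "finite \<V>" and cov: "\<Union>\<V> = topspace X"
      and ord: "\<forall>x\<in>topspace X. int (card {V\<in>\<V>. x \<in> V}) \<le> - 1 + 1"
    using le[unfolded covering_dim_le_def, rule_format, OF U] by (elim exE conjE)
  have False if x: "x \<in> topspace X" for x
  proof -
    obtain V where V: "V \<in> \<V>" "x \<in> V"
      using x unfolding cov[symmetric] by (rule UnionE)
    have "card {V\<in>\<V>. x \<in> V} = 0"
      using bspec[OF ord x] by simp
    then have "{V\<in>\<V>. x \<in> V} = {}"
      using fin by simp
    with V show False by blast
  qed
  then show "topspace X = {}" by blast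
next
  assume e: "topspace X = {}"
  show "covering_dim_le X (- 1)"
    unfolding covering_dim_le_def e by (intro allI impI exI[of _ "{}"] conjI) simp_all
qed

section \<open>Complex matrices as topological spaces\<close>

text \<open>
  The type of complex matrices carries no topology; the \<open>n \<times> n\<close> matrices get the one
  of \<open>\<complex>\<close> to the power \<open>n \<times> n\<close> (product topology on the entries).
\<close>

definition mat_topology :: "nat \<Rightarrow> complex mat topology" where
  "mat_topology n =
     pullback_topology (carrier_mat n n) (\<lambda>A. \<lambda>ij\<in>{..<n} \<times> {..<n}. A $$ ij)
       (product_topology (\<lambda>_. euclidean) ({..<n} \<times> {..<n}))"

definition SL_topology :: "nat \<Rightarrow> complex mat topology" where
  "SL_topology n = subtopology (mat_topology n) {A. Determinant.det A = 1}"

lemma topspace_mat_topology: "topspace (mat_topology n) = carrier_mat n n"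
  unfolding mat_topology_def topspace_pullback_topology by auto

lemma topspace_SL_topology:
  "topspace (SL_topology n) = {A \<in> carrier_mat n n. Determinant.det A = 1}"
  unfolding SL_topology_def by (auto simp: topspace_mat_topology)

definition null_homotopic_SL :: "'a topology \<Rightarrow> nat \<Rightarrow> ('a \<Rightarrow> complex mat) \<Rightarrow> bool" where
  "null_homotopic_SL X n f \<longleftrightarrow>
     (\<exists>C\<in>topspace (SL_topology n). homotopic_with (\<lambda>_. True) X (SL_topology n) f (\<lambda>_. C))"

section \<open>Matrices over the ring of continuous functions\<close>

text \<open>
  A matrix with entries in \<open>\<C>(X)\<close> is represented by the matrix-valued function
  \<open>F\<close> whose \<open>(i,j)\<close> entry is the function \<open>\<lambda>x. F x $$ (i,j)\<close>.  Values outside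
  \<open>topspace X\<close> are irrelevant; accordingly, equations between matrices over \<open>\<C>(X)\<close>
  are equations of values at all points of \<open>topspace X\<close>.
\<close>

definition cont_mat :: "'a topology \<Rightarrow> nat \<Rightarrow> ('a \<Rightarrow> complex mat) set" where
  "cont_mat X n = {F. (\<forall>x\<in>topspace X. F x \<in> carrier_mat n n) \<and>
     (\<forall>i<n. \<forall>j<n. continuous_map X euclidean (\<lambda>x. F x $$ (i,j)))}"

lemma continuous_map_mat_topology_iff:
  "continuous_map X (mat_topology n) F \<longleftrightarrow> F \<in> cont_mat X n"
proof -
  let ?I = "{..<n} \<times> {..<n}"
  let ?e = "\<lambda>A::complex mat. \<lambda>ij\<in>?I. A $$ ij"
  let ?P = "product_topology (\<lambda>_. euclidean :: complex topology) ?I"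
  have entries: "continuous_map X ?P (?e \<circ> F) \<longleftrightarrow>
      (\<forall>i<n. \<forall>j<n. continuous_map X euclidean (\<lambda>x. F x $$ (i,j)))"
    by (auto simp: continuous_map_componentwise o_def)
  have "continuous_map X (mat_topology n) F \<longleftrightarrow>
      F ` topspace X \<subseteq> carrier_mat n n \<and> continuous_map X ?P (?e \<circ> F)"
  proof
    assume F: "continuous_map X (mat_topology n) F"
    have "continuous_map (mat_topology n) ?P (id \<circ> ?e)"
      unfolding mat_topology_def by (rule continuous_map_pullback) simp
    then have "continuous_map X ?P (?e \<circ> F)"
      using continuous_map_compose[OF F, of ?P ?e] by simp
    moreover have "F ` topspace X \<subseteq> carrier_mat n n"
      using continuous_map_image_subset_topspace[OF F] by (simp add: topspace_mat_topology)
    ultimately show "F ` topspace X \<subseteq> carrier_mat n n \<and> continuous_map X ?P (?e \<circ> F)"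
      by blast
  next
    assume "F ` topspace X \<subseteq> carrier_mat n n \<and> continuous_map X ?P (?e \<circ> F)"
    then show "continuous_map X (mat_topology n) F"
      unfolding mat_topology_def by (intro continuous_map_pullback') auto
  qed
  then show ?thesis
    unfolding entries cont_mat_def by auto
qed

lemma continuous_map_SL_topology_iff:
  "continuous_map X (SL_topology n) F \<longleftrightarrow>
     F \<in> cont_mat X n \<and> (\<forall>x\<in>topspace X. Determinant.det (F x) = 1)"
  unfolding SL_topology_def
  by (auto simp: continuous_map_in_subtopology continuous_map_mat_topology_iff)

definition cont_GL :: "'a topology \<Rightarrow> nat \<Rightarrow> ('a \<Rightarrow> complex mat) set" where
  "cont_GL X n = {F \<in> cont_mat X n.
     \<exists>G\<in>cont_mat X n. \<forall>x\<in>topspace X. F x * G x = 1\<^sub>m n \<and> G x * F x = 1\<^sub>m n}"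

definition cont_involutions :: "'a topology \<Rightarrow> nat \<Rightarrow> ('a \<Rightarrow> complex mat) set" where
  "cont_involutions X n = {B \<in> cont_GL X n. \<forall>x\<in>topspace X. B x * B x = 1\<^sub>m n}"

definition lower_triangular :: "'b::zero mat \<Rightarrow> bool" where
  "lower_triangular A \<longleftrightarrow> (\<forall>i<dim_row A. \<forall>j<dim_col A. i < j \<longrightarrow> A $$ (i,j) = 0)"

text \<open>The choice between upper and lower is made once for the whole matrix over
  \<open>\<C>(X)\<close>, not separately at each point.\<close>

definition cont_unitriangular :: "'a topology \<Rightarrow> nat \<Rightarrow> ('a \<Rightarrow> complex mat) set" where
  "cont_unitriangular X n = {F \<in> cont_mat X n.
     (\<forall>x\<in>topspace X. \<forall>i<n. F x $$ (i,i) = 1) \<and>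
     ((\<forall>x\<in>topspace X. upper_triangular (F x)) \<or> (\<forall>x\<in>topspace X. lower_triangular (F x)))}"

text \<open>The empty product is the identity matrix.\<close>

definition is_product_of_at_most ::
  "'a topology \<Rightarrow> nat \<Rightarrow> nat \<Rightarrow> ('a \<Rightarrow> complex mat) set \<Rightarrow> ('a \<Rightarrow> complex mat) \<Rightarrow> bool" where
  "is_product_of_at_most X n m S f \<longleftrightarrow>
     (\<exists>Fs. length Fs \<le> m \<and> set Fs \<subseteq> S \<and>
        (\<forall>x\<in>topspace X. f x = foldr (*) (map (\<lambda>F. F x) Fs) (1\<^sub>m n)))"

end

theory Submission
  imports Defs
begin

text \<open>
  Choose a constant invertible diagonal matrix \<open>D\<close> with distinct diagonal entries that is
  inverted by reversing the order of the coordinates.  Then \<open>D\<close> and its inverse are each a product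
  of two involutions.  If \<open>U\<close> is unitriangular over \<open>\<C>(T)\<close>, then \<open>U D\<close> is triangular with the
  diagonal of \<open>D\<close>, whose differences are units, so it is conjugate to \<open>D\<close> over \<open>\<C>(T)\<close>; likewise
  for \<open>D\<^sup>-\<^sup>1 V\<close>.  Hence \<open>U V = (U D) (D\<^sup>-\<^sup>1 V)\<close> is a product of four involutions, and the factors
  of \<open>f\<close> can be grouped in pairs.
\<close>

section \<open>Matrices of continuous functions\<close>

lemma mat_mult_entry:
  assumes "A \<in> carrier_mat n n" "B \<in> carrier_mat n n" "i < n" "j < n"
  shows "(A * B) $$ (i,j) = (\<Sum>k<n. A $$ (i,k) * B $$ (k,j))"
  using assms by (simp add: scalar_prod_def atLeast0LessThan)

lemma cont_mat_const: "A \<in> carrier_mat n n \<Longrightarrow> (\<lambda>x. A) \<in> cont_mat X n"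
  by (simp add: cont_mat_def)

lemma cont_mat_carrier: "F \<in> cont_mat X n \<Longrightarrow> x \<in> topspace X \<Longrightarrow> F x \<in> carrier_mat n n"
  by (simp add: cont_mat_def)

lemma cont_mat_entry:
  "F \<in> cont_mat X n \<Longrightarrow> i < n \<Longrightarrow> j < n \<Longrightarrow> continuous_map X euclidean (\<lambda>x. F x $$ (i,j))"
  by (simp add: cont_mat_def)

lemma cont_mat_mat:
  assumes "\<And>i j. i < n \<Longrightarrow> j < n \<Longrightarrow> continuous_map X euclidean (\<lambda>x. h x i j)"
  shows "(\<lambda>x. mat n n (\<lambda>(i,j). h x i j)) \<in> cont_mat X n"
  using assms by (simp add: cont_mat_def)

lemma continuous_map_mult_complex:
  fixes f g :: "'a \<Rightarrow> complex"
  assumes "continuous_map X euclidean f" "continuous_map X euclidean g"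
  shows "continuous_map X euclidean (\<lambda>x. f x * g x)"
  using assms by (simp add: continuous_map_atin tendsto_mult)

lemma continuous_map_prod_complex:
  fixes f :: "'a \<Rightarrow> 'b \<Rightarrow> complex"
  assumes "\<And>i. i \<in> I \<Longrightarrow> continuous_map X euclidean (\<lambda>x. f x i)"
  shows "continuous_map X euclidean (\<lambda>x. \<Prod>i\<in>I. f x i)"
  using assms by (simp add: continuous_map_atin tendsto_prod)

lemma cont_mat_mult:
  assumes F: "F \<in> cont_mat X n" and G: "G \<in> cont_mat X n"
  shows "(\<lambda>x. F x * G x) \<in> cont_mat X n"
  unfolding cont_mat_def
proof (intro CollectI conjI ballI allI impI)
  fix x assume "x \<in> topspace X"
  then show "F x * G x \<in> carrier_mat n n"
    using cont_mat_carrier[OF F] cont_mat_carrier[OF G] by (meson mult_carrier_mat)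
next
  fix i j assume ij: "i < n" "j < n"
  have "continuous_map X euclidean (\<lambda>x. \<Sum>k<n. F x $$ (i,k) * G x $$ (k,j))"
    using ij by (intro continuous_map_sum continuous_map_mult_complex cont_mat_entry[OF F]
        cont_mat_entry[OF G]) auto
  then show "continuous_map X euclidean (\<lambda>x. (F x * G x) $$ (i,j))"
    by (rule continuous_map_eq)
      (simp add: mat_mult_entry[OF cont_mat_carrier[OF F] cont_mat_carrier[OF G] ij])
qed

lemma cont_mat_transpose:
  assumes "F \<in> cont_mat X n"
  shows "(\<lambda>x. (F x)\<^sup>T) \<in> cont_mat X n"
  unfolding cont_mat_def
proof (intro CollectI conjI ballI allI impI)
  fix x assume "x \<in> topspace X"
  then show "(F x)\<^sup>T \<in> carrier_mat n n"
    using cont_mat_carrier[OF assms] by simp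
next
  fix i j assume ij: "i < n" "j < n"
  show "continuous_map X euclidean (\<lambda>x. (F x)\<^sup>T $$ (i,j))"
    by (rule continuous_map_eq[OF cont_mat_entry[OF assms ij(2,1)]])
      (simp add: ij carrier_matD[OF cont_mat_carrier[OF assms]])
qed

section \<open>Determinants, minors and adjugates of matrices of continuous functions\<close>

lemma continuous_map_det:
  assumes F: "F \<in> cont_mat X n"
  shows "continuous_map X euclidean (\<lambda>x. Determinant.det (F x))"
proof -
  have "continuous_map X euclidean
      (\<lambda>x. \<Sum>p\<in>{p. p permutes {0..<n}}. signof p * (\<Prod>i = 0..<n. F x $$ (i, p i)))"
    by (intro continuous_map_sum continuous_map_mult_complex continuous_map_prod_complex
        cont_mat_entry[OF F])
      (auto simp: finite_permutations dest: permutes_in_image)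
  then show ?thesis
    by (rule continuous_map_eq) (simp add: det_def'[OF cont_mat_carrier[OF F]])
qed

lemma cont_mat_delete:
  assumes F: "F \<in> cont_mat X n"
  shows "(\<lambda>x. mat_delete (F x) k l) \<in> cont_mat X (n - 1)"
  unfolding cont_mat_def
proof (intro CollectI conjI ballI allI impI)
  fix x assume "x \<in> topspace X"
  then show "mat_delete (F x) k l \<in> carrier_mat (n - 1) (n - 1)"
    using carrier_matD[OF cont_mat_carrier[OF F]] by (simp add: mat_delete_def)
next
  fix i j assume ij: "i < n - 1" "j < n - 1"
  have "continuous_map X euclidean
      (\<lambda>x. F x $$ (if i < k then i else Suc i, if j < l then j else Suc j))"
    using ij by (intro cont_mat_entry[OF F]) auto
  then show "continuous_map X euclidean (\<lambda>x. mat_delete (F x) k l $$ (i,j))"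
    by (rule continuous_map_eq) (use ij in \<open>auto simp: mat_delete_def carrier_matD[OF cont_mat_carrier[OF F]]\<close>)
qed

text \<open>Entries of the adjugate are signed minors, hence polynomials in the entries of
  \<open>F\<close>. When the determinant is 1 the adjugate is the inverse, so this yields inverses
  over the ring of continuous functions.\<close>

lemma cont_mat_adj:
  assumes F: "F \<in> cont_mat X n"
  shows "(\<lambda>x. adj_mat (F x)) \<in> cont_mat X n"
  unfolding cont_mat_def
proof (intro CollectI conjI ballI allI impI)
  fix x assume "x \<in> topspace X"
  then show "adj_mat (F x) \<in> carrier_mat n n"
    using adj_mat(1) cont_mat_carrier[OF F] by blast
next
  fix i j assume ij: "i < n" "j < n"
  have "continuous_map X euclidean (\<lambda>x. (-1) ^ (j + i) * Determinant.det (mat_delete (F x) j i))"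
    by (intro continuous_map_mult_complex continuous_map_det[OF cont_mat_delete[OF F]]) simp
  then show "continuous_map X euclidean (\<lambda>x. adj_mat (F x) $$ (i,j))"
    by (rule continuous_map_eq)
      (use ij in \<open>auto simp: adj_mat_def cofactor_def carrier_matD[OF cont_mat_carrier[OF F]]\<close>)
qed

section \<open>Products of two involutions\<close>

text \<open>An involution is its own inverse, which supplies the witness required by
  \<open>cont_GL\<close>.\<close>

lemma cont_involutions_iff:
  "B \<in> cont_involutions X n \<longleftrightarrow> B \<in> cont_mat X n \<and> (\<forall>x\<in>topspace X. B x * B x = 1\<^sub>m n)"
  by (auto simp: cont_involutions_def cont_GL_def)

definition product_of_two_involutions :: "'a topology \<Rightarrow> nat \<Rightarrow> ('a \<Rightarrow> complex mat) \<Rightarrow> bool" where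
  "product_of_two_involutions X n F \<longleftrightarrow>
     (\<exists>B\<in>cont_involutions X n. \<exists>C\<in>cont_involutions X n. \<forall>x\<in>topspace X. F x = B x * C x)"

lemma product_of_two_involutionsI:
  assumes "B \<in> cont_involutions X n" "C \<in> cont_involutions X n"
    and "\<And>x. x \<in> topspace X \<Longrightarrow> F x = B x * C x"
  shows "product_of_two_involutions X n F"
  unfolding product_of_two_involutions_def using assms by blast

lemma cont_involutions_conj:
  assumes B: "B \<in> cont_involutions X n" and G: "G \<in> cont_mat X n" and H: "H \<in> cont_mat X n"
    and HG: "\<And>x. x \<in> topspace X \<Longrightarrow> H x * G x = 1\<^sub>m n"
    and GH: "\<And>x. x \<in> topspace X \<Longrightarrow> G x * H x = 1\<^sub>m n"
  shows "(\<lambda>x. G x * B x * H x) \<in> cont_involutions X n"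
  unfolding cont_involutions_iff
proof (intro conjI ballI)
  have Bm: "B \<in> cont_mat X n"
    using B by (simp add: cont_involutions_iff)
  show "(\<lambda>x. G x * B x * H x) \<in> cont_mat X n"
    by (intro cont_mat_mult G H Bm)
  fix x assume x: "x \<in> topspace X"
  note c = cont_mat_carrier[OF Bm x] cont_mat_carrier[OF G x] cont_mat_carrier[OF H x]
  have BB: "B x * B x = 1\<^sub>m n"
    using B x by (simp add: cont_involutions_iff)
  have "(G x * B x * H x) * (G x * B x * H x) = G x * B x * (H x * G x) * B x * H x"
    using c by (simp add: assoc_mult_mat[of _ n n _ n _ n])
  also have "\<dots> = G x * (B x * B x) * H x"
    unfolding HG[OF x] using c by (simp add: assoc_mult_mat[of _ n n _ n _ n])
  also have "\<dots> = 1\<^sub>m n"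
    unfolding BB using c GH[OF x] by simp
  finally show "(G x * B x * H x) * (G x * B x * H x) = 1\<^sub>m n" .
qed

text \<open>Conjugate each of the two involutions separately; the inner factor
  \<open>H x * G x\<close> cancels. \<open>K\<close> is tied to the conjugate only on
  \<open>topspace X\<close>, so that pointwise equations suffice in applications.\<close>

lemma product_of_two_involutions_conj:
  assumes F: "product_of_two_involutions X n F" and G: "G \<in> cont_mat X n" and H: "H \<in> cont_mat X n"
    and HG: "\<And>x. x \<in> topspace X \<Longrightarrow> H x * G x = 1\<^sub>m n"
    and GH: "\<And>x. x \<in> topspace X \<Longrightarrow> G x * H x = 1\<^sub>m n"
    and K: "\<And>x. x \<in> topspace X \<Longrightarrow> K x = G x * F x * H x"
  shows "product_of_two_involutions X n K"
proof -
  obtain B C where B: "B \<in> cont_involutions X n" and C: "C \<in> cont_involutions X n"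
    and eq: "\<And>x. x \<in> topspace X \<Longrightarrow> F x = B x * C x"
    using F by (auto simp: product_of_two_involutions_def)
  have "K x = (G x * B x * H x) * (G x * C x * H x)" if x: "x \<in> topspace X" for x
  proof -
    have c: "B x \<in> carrier_mat n n" "C x \<in> carrier_mat n n" "G x \<in> carrier_mat n n" "H x \<in> carrier_mat n n"
      using B C G H x by (auto simp: cont_involutions_iff cont_mat_carrier)
    have "(G x * B x * H x) * (G x * C x * H x) = G x * B x * (H x * G x) * C x * H x"
      using c by (simp add: assoc_mult_mat[of _ n n _ n _ n])
    also have "\<dots> = G x * (B x * C x) * H x"
      unfolding HG[OF x] using c by (simp add: assoc_mult_mat[of _ n n _ n _ n])
    finally show ?thesis
      by (simp add: K[OF x] eq[OF x])
  qed
  then show ?thesis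
    by (intro product_of_two_involutionsI[OF cont_involutions_conj[OF B G H HG GH]
          cont_involutions_conj[OF C G H HG GH]])
qed

text \<open>The transpose of an involution is an involution, and transposition merely reverses the
  two factors. This is what reduces upper triangular matrices to lower triangular ones.\<close>

lemma product_of_two_involutions_transpose:
  assumes F: "product_of_two_involutions X n F"
    and K: "\<And>x. x \<in> topspace X \<Longrightarrow> K x = (F x)\<^sup>T"
  shows "product_of_two_involutions X n K"
proof -
  have inv: "(\<lambda>x. (B x)\<^sup>T) \<in> cont_involutions X n" if B: "B \<in> cont_involutions X n" for B
    unfolding cont_involutions_iff
  proof (intro conjI ballI)
    show "(\<lambda>x. (B x)\<^sup>T) \<in> cont_mat X n"
      using B by (simp add: cont_involutions_iff cont_mat_transpose)
    fix x assume "x \<in> topspace X"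
    then have "B x \<in> carrier_mat n n" "B x * B x = 1\<^sub>m n"
      using B by (auto simp: cont_involutions_iff cont_mat_carrier)
    then show "(B x)\<^sup>T * (B x)\<^sup>T = 1\<^sub>m n"
      by (metis transpose_mult transpose_one)
  qed
  obtain B C where B: "B \<in> cont_involutions X n" and C: "C \<in> cont_involutions X n"
    and eq: "\<And>x. x \<in> topspace X \<Longrightarrow> F x = B x * C x"
    using F by (auto simp: product_of_two_involutions_def)
  have "K x = (C x)\<^sup>T * (B x)\<^sup>T" if x: "x \<in> topspace X" for x
  proof -
    have "B x \<in> carrier_mat n n" "C x \<in> carrier_mat n n"
      using B C x by (auto simp: cont_involutions_iff cont_mat_carrier)
    then show ?thesis
      by (simp add: K[OF x] eq[OF x] transpose_mult)
  qed
  then show ?thesis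
    by (rule product_of_two_involutionsI[OF inv[OF C] inv[OF B]])
qed

section \<open>Unitriangular matrices times a diagonal matrix\<close>

definition diag_of :: "nat \<Rightarrow> (nat \<Rightarrow> complex) \<Rightarrow> complex mat" where
  "diag_of n d = mat n n (\<lambda>(i,j). if i = j then d i else 0)"

lemma diag_of_carrier [simp]: "diag_of n d \<in> carrier_mat n n"
  by (simp add: diag_of_def)

lemma mult_diag_of_entry:
  assumes "A \<in> carrier_mat n n" "i < n" "j < n"
  shows "(A * diag_of n d) $$ (i,j) = A $$ (i,j) * d j"
proof -
  have "(A * diag_of n d) $$ (i,j) = (\<Sum>k<n. A $$ (i,k) * diag_of n d $$ (k,j))"
    by (rule mat_mult_entry) (use assms in auto)
  also have "\<dots> = (\<Sum>k<n. if k = j then A $$ (i,k) * d k else 0)"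
    by (rule sum.cong) (use assms in \<open>auto simp: diag_of_def\<close>)
  finally show ?thesis
    using assms by simp
qed

lemma diag_of_mult:
  assumes "\<And>i. i < n \<Longrightarrow> d i * e i = 1"
  shows "diag_of n d * diag_of n e = 1\<^sub>m n"
proof (rule eq_matI)
  fix i j assume "i < dim_row (1\<^sub>m n :: complex mat)" "j < dim_col (1\<^sub>m n :: complex mat)"
  then show "(diag_of n d * diag_of n e) $$ (i,j) = 1\<^sub>m n $$ (i,j)"
    using assms by (subst mult_diag_of_entry) (auto simp: diag_of_def)
qed (auto simp: diag_of_def)

lemma transpose_diag_of: "(diag_of n d)\<^sup>T = diag_of n d"
  by (rule eq_matI) (auto simp: diag_of_def)

section \<open>Antidiagonal matrices and diagonal matrices inverted by reversal\<close>

definition antidiag_of :: "nat \<Rightarrow> (nat \<Rightarrow> complex) \<Rightarrow> complex mat" where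
  "antidiag_of n d = mat n n (\<lambda>(i,j). if i + j + 1 = n then d i else 0)"

lemma antidiag_of_mult:
  "antidiag_of n d * antidiag_of n e = diag_of n (\<lambda>i. d i * e (n - 1 - i))"
proof (rule eq_matI)
  fix i j
  assume "i < dim_row (diag_of n (\<lambda>i. d i * e (n - 1 - i)))"
    "j < dim_col (diag_of n (\<lambda>i. d i * e (n - 1 - i)))"
  then have ij: "i < n" "j < n" by (auto simp: diag_of_def)
  have "(antidiag_of n d * antidiag_of n e) $$ (i,j)
      = (\<Sum>k<n. antidiag_of n d $$ (i,k) * antidiag_of n e $$ (k,j))"
    by (rule mat_mult_entry) (use ij in \<open>auto simp: antidiag_of_def\<close>)
  \<comment> \<open>Row \<open>i\<close> of the first factor is supported in column
    \<open>n - 1 - i\<close>, and that row of the second factor is supported back in column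
    \<open>i\<close>.\<close>
  also have "\<dots> = (\<Sum>k<n. if k = n - 1 - i then (if i = j then d i * e k else 0) else 0)"
    by (rule sum.cong) (use ij in \<open>auto simp: antidiag_of_def\<close>)
  also have "\<dots> = diag_of n (\<lambda>i. d i * e (n - 1 - i)) $$ (i,j)"
    using ij by (simp add: diag_of_def)
  finally show "(antidiag_of n d * antidiag_of n e) $$ (i,j)
      = diag_of n (\<lambda>i. d i * e (n - 1 - i)) $$ (i,j)" .
qed (auto simp: diag_of_def antidiag_of_def)

text \<open>Let J be the antidiagonal matrix of ones, an involution, and write D = (D J) J.
  Conjugation by J reverses the diagonal, so (D J)(D J) = D (J D J) is the identity exactly when
  reversal inverts D.\<close>

lemma product_of_two_involutions_diag_of:
  assumes "\<And>i. i < n \<Longrightarrow> d i * d (n - 1 - i) = 1"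
  shows "product_of_two_involutions X n (\<lambda>x. diag_of n d)"
proof -
  have one: "diag_of n e = 1\<^sub>m n" if "\<And>i. i < n \<Longrightarrow> e i = 1" for e
    by (rule eq_matI) (use that in \<open>auto simp: diag_of_def\<close>)
  have inv: "(\<lambda>x. antidiag_of n e) \<in> cont_involutions X n"
    if "\<And>i. i < n \<Longrightarrow> e i * e (n - 1 - i) = 1" for e
    unfolding cont_involutions_iff antidiag_of_mult using that
    by (simp add: cont_mat_const antidiag_of_def one)
  have "diag_of n d = antidiag_of n d * antidiag_of n (\<lambda>_. 1)"
    by (simp add: antidiag_of_mult)
  then show ?thesis
    unfolding product_of_two_involutions_def using inv[of d] inv[of "\<lambda>_. 1"] assms by auto
qed

text \<open>
  The entries of the lower unitriangular matrix \<open>X\<close> solving \<open>U D X = X D\<close>: for \<open>j < i\<close> the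
  \<open>(i,j)\<close> entry of this equation determines \<open>X\<^sub>i\<^sub>j\<close> from the entries of \<open>X\<close> in earlier rows.
\<close>

fun conj_entry :: "(nat \<Rightarrow> complex) \<Rightarrow> complex mat \<Rightarrow> nat \<Rightarrow> nat \<Rightarrow> complex" where
  "conj_entry d U i j =
     (if i < j then 0 else if i = j then 1
      else (\<Sum>k<i. U $$ (i,k) * d k * conj_entry d U k j) * inverse (d j - d i))"

declare conj_entry.simps [simp del]

lemma conj_entry_above [simp]: "i < j \<Longrightarrow> conj_entry d U i j = 0"
  by (simp add: conj_entry.simps)

lemma conj_entry_diag [simp]: "conj_entry d U i i = 1"
  by (simp add: conj_entry.simps)

text \<open>Strong induction on the row: since \<open>d\<close> is constant, the recursion only
  forms sums and products of entries of \<open>U\<close>, earlier entries and constants. No division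
  by a function occurs.\<close>

lemma continuous_map_conj_entry:
  assumes U: "U \<in> cont_mat X n" and "i < n"
  shows "continuous_map X euclidean (\<lambda>x. conj_entry d (U x) i j)"
  using \<open>i < n\<close>
proof (induction i rule: less_induct)
  case (less i)
  show ?case
  proof (cases "j < i")
    case True
    have "continuous_map X euclidean
        (\<lambda>x. (\<Sum>k<i. U x $$ (i,k) * d k * conj_entry d (U x) k j) * inverse (d j - d i))"
      using less by (intro continuous_map_sum continuous_map_mult_complex cont_mat_entry[OF U]) auto
    with True show ?thesis
      by (subst conj_entry.simps) simp
  next
    case False
    then show ?thesis
      by (subst conj_entry.simps) simp
  qed
qed

definition conj_mat :: "nat \<Rightarrow> (nat \<Rightarrow> complex) \<Rightarrow> complex mat \<Rightarrow> complex mat" where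
  "conj_mat n d U = mat n n (\<lambda>(i,j). conj_entry d U i j)"

lemma conj_mat_carrier [simp]: "conj_mat n d U \<in> carrier_mat n n"
  by (simp add: conj_mat_def)

lemma det_conj_mat: "Determinant.det (conj_mat n d U) = 1"
proof -
  have "diag_mat (conj_mat n d U) = map (\<lambda>_. 1) [0..<n]"
    by (auto simp: diag_mat_def conj_mat_def)
  moreover have "Determinant.det (conj_mat n d U) = prod_list (diag_mat (conj_mat n d U))"
    by (rule det_lower_triangular[of n]) (auto simp: conj_mat_def)
  ultimately show ?thesis
    by (simp add: map_replicate_const)
qed

text \<open>Write X for \<open>conj_mat n d U\<close> and compare entries. The \<open>k = i\<close>
  term on the left is \<open>d i\<close> times the (i,j) entry of X, so for \<open>j < i\<close>
  equality says that the sum over \<open>k < i\<close> equals that entry times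
  \<open>d j - d i\<close>. This is the recursion defining \<open>conj_entry\<close>, solvable
  because the values of \<open>d\<close> are distinct.\<close>

lemma conj_mat_eq:
  assumes U: "U \<in> carrier_mat n n" and low: "lower_triangular U" and one: "\<And>i. i < n \<Longrightarrow> U $$ (i,i) = 1"
    and inj: "inj_on d {..<n}"
  shows "U * diag_of n d * conj_mat n d U = conj_mat n d U * diag_of n d"
proof (rule eq_matI)
  fix i j
  assume "i < dim_row (conj_mat n d U * diag_of n d)" "j < dim_col (conj_mat n d U * diag_of n d)"
  then have ij: "i < n" "j < n"
    by (auto simp: conj_mat_def diag_of_def)
  let ?x = "\<lambda>k. conj_entry d U k j"
  let ?t = "\<lambda>k. U $$ (i,k) * d k * ?x k"
  have "(U * diag_of n d * conj_mat n d U) $$ (i,j)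
      = (\<Sum>k<n. (U * diag_of n d) $$ (i,k) * conj_mat n d U $$ (k,j))"
    by (rule mat_mult_entry) (use U ij in auto)
  also have "\<dots> = (\<Sum>k<n. ?t k)"
    by (rule sum.cong) (use U ij in \<open>auto simp: mult_diag_of_entry conj_mat_def simp del: index_mult_mat\<close>)
  also have "\<dots> = (\<Sum>k\<in>{..i}. ?t k)"
    by (rule sum.mono_neutral_right) (use U low ij in \<open>auto simp: lower_triangular_def\<close>)
  also have "\<dots> = (\<Sum>k<i. ?t k) + d i * ?x i"
    using one[OF ij(1)] by (simp add: lessThan_Suc_atMost[symmetric])
  also have "\<dots> = ?x i * d j"
  proof (cases "j < i")
    case True
    then have "d j - d i \<noteq> 0"
      using inj ij by (auto simp: inj_on_def)
    moreover have "?x i = (\<Sum>k<i. ?t k) * inverse (d j - d i)"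
      using True by (subst conj_entry.simps) simp
    ultimately have "(\<Sum>k<i. ?t k) = ?x i * (d j - d i)"
      by simp
    then show ?thesis
      by (simp add: algebra_simps)
  next
    case False
    \<comment> \<open>Here \<open>k < i\<close> and \<open>i \<le> j\<close>, so every
      \<open>?x k\<close> lies above the diagonal and vanishes.\<close>
    then have "(\<Sum>k<i. ?t k) = 0"
      by (intro sum.neutral) auto
    with False show ?thesis
      by (cases "i = j") auto
  qed
  also have "\<dots> = (conj_mat n d U * diag_of n d) $$ (i,j)"
    using ij by (subst mult_diag_of_entry) (auto simp: conj_mat_def)
  finally show "(U * diag_of n d * conj_mat n d U) $$ (i,j) = (conj_mat n d U * diag_of n d) $$ (i,j)" .
qed (use U in \<open>auto simp: conj_mat_def diag_of_def\<close>)

text \<open>With X the matrix \<open>conj_mat n d (U x)\<close>, the equation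
  \<open>conj_mat_eq\<close> gives U D = X D X^(-1), and D itself is a product of two
  involutions.\<close>

lemma lower_mult_diag:
  assumes U: "U \<in> cont_mat X n" and low: "\<And>x. x \<in> topspace X \<Longrightarrow> lower_triangular (U x)"
    and one: "\<And>x i. x \<in> topspace X \<Longrightarrow> i < n \<Longrightarrow> U x $$ (i,i) = 1"
    and inj: "inj_on d {..<n}" and sym: "\<And>i. i < n \<Longrightarrow> d i * d (n - 1 - i) = 1"
  shows "product_of_two_involutions X n (\<lambda>x. U x * diag_of n d)"
proof (rule product_of_two_involutions_conj)
  let ?G = "\<lambda>x. conj_mat n d (U x)"
  show "product_of_two_involutions X n (\<lambda>x. diag_of n d)"
    by (rule product_of_two_involutions_diag_of) (rule sym)
  show G: "?G \<in> cont_mat X n"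
    unfolding conj_mat_def by (intro cont_mat_mat continuous_map_conj_entry[OF U])
  show "(\<lambda>x. adj_mat (?G x)) \<in> cont_mat X n"
    by (rule cont_mat_adj[OF G])
  fix x assume x: "x \<in> topspace X"
  \<comment> \<open>The product of a matrix with its adjugate is its determinant times the identity;
    the determinant here is 1.\<close>
  note adj = adj_mat[OF conj_mat_carrier[of n d "U x"], unfolded det_conj_mat]
  show "adj_mat (?G x) * ?G x = 1\<^sub>m n" "?G x * adj_mat (?G x) = 1\<^sub>m n"
    using adj by auto
  then have "U x * diag_of n d = U x * diag_of n d * (?G x * adj_mat (?G x))"
    using cont_mat_carrier[OF U x] by (simp add: right_mult_one_mat[of _ n n])
  also have "\<dots> = U x * diag_of n d * ?G x * adj_mat (?G x)"
    using cont_mat_carrier[OF U x] adj(1)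
    by (intro assoc_mult_mat[symmetric, of _ n n _ n _ n]) auto
  also have "\<dots> = ?G x * diag_of n d * adj_mat (?G x)"
    by (simp add: conj_mat_eq[OF cont_mat_carrier[OF U x] low[OF x] one[OF x] inj])
  finally show "U x * diag_of n d = ?G x * diag_of n d * adj_mat (?G x)" .
qed

text \<open>D U = D (U D) D^(-1) is conjugate to the product in the other order. By
  \<open>sym\<close>, the inverse of D has the reversed diagonal, which is \<open>?E\<close> in the
  proof.\<close>

lemma lower_diag_mult:
  assumes U: "U \<in> cont_mat X n" and low: "\<And>x. x \<in> topspace X \<Longrightarrow> lower_triangular (U x)"
    and one: "\<And>x i. x \<in> topspace X \<Longrightarrow> i < n \<Longrightarrow> U x $$ (i,i) = 1"
    and inj: "inj_on d {..<n}" and sym: "\<And>i. i < n \<Longrightarrow> d i * d (n - 1 - i) = 1"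
  shows "product_of_two_involutions X n (\<lambda>x. diag_of n d * U x)"
proof (rule product_of_two_involutions_conj)
  let ?D = "diag_of n d" and ?E = "diag_of n (\<lambda>i. d (n - 1 - i))"
  show "product_of_two_involutions X n (\<lambda>x. U x * ?D)"
    by (rule lower_mult_diag) (use assms in auto)
  show "(\<lambda>x. ?D) \<in> cont_mat X n" "(\<lambda>x. ?E) \<in> cont_mat X n"
    by (auto intro: cont_mat_const)
  show "?E * ?D = 1\<^sub>m n" and DE: "?D * ?E = 1\<^sub>m n"
    by (rule diag_of_mult, use sym in \<open>simp add: mult.commute\<close>)+
  fix x assume x: "x \<in> topspace X"
  show "?D * U x = ?D * (U x * ?D) * ?E"
    using cont_mat_carrier[OF U x] DE by (simp add: assoc_mult_mat[of _ n n _ n _ n])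
qed

lemma unitriangular_diag:
  assumes U: "U \<in> cont_unitriangular X n"
    and inj: "inj_on d {..<n}" and sym: "\<And>i. i < n \<Longrightarrow> d i * d (n - 1 - i) = 1"
  shows "product_of_two_involutions X n (\<lambda>x. U x * diag_of n d)" (is ?right)
    and "product_of_two_involutions X n (\<lambda>x. diag_of n d * U x)" (is ?left)
proof -
  have Um: "U \<in> cont_mat X n" and one: "\<And>x i. x \<in> topspace X \<Longrightarrow> i < n \<Longrightarrow> U x $$ (i,i) = 1"
    using U by (auto simp: cont_unitriangular_def)
  have c: "U x \<in> carrier_mat n n" if "x \<in> topspace X" for x
    by (rule cont_mat_carrier[OF Um that])
  have "?right \<and> ?left"
  proof (cases "\<forall>x\<in>topspace X. lower_triangular (U x)")
    case True
    then show ?thesis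
      using lower_mult_diag[OF Um _ one inj sym] lower_diag_mult[OF Um _ one inj sym] by blast
  next
    case False
    \<comment> \<open>The type is chosen uniformly over the space, so a \<open>U\<close> that fails
      to be lower triangular somewhere is upper triangular everywhere.\<close>
    then have up: "\<forall>x\<in>topspace X. upper_triangular (U x)"
      using U by (auto simp: cont_unitriangular_def)
    have low: "lower_triangular ((U x)\<^sup>T)" if "x \<in> topspace X" for x
      using up that c[OF that] by (auto simp: lower_triangular_def upper_triangular_def)
    have one': "(U x)\<^sup>T $$ (i,i) = 1" if "x \<in> topspace X" "i < n" for x i
      using c[OF that(1)] one that by simp
    show ?thesis
    proof
      \<comment> \<open>Transposition moves D to the other side: the transpose of U D is D times the
        transpose of U. So each product is settled by the lower triangular lemma for the opposite
        side.\<close>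
      show ?right
        by (rule product_of_two_involutions_transpose
            [OF lower_diag_mult[OF cont_mat_transpose[OF Um] low one' inj sym]])
          (use c in \<open>auto simp: transpose_mult[of _ n n _ n] transpose_diag_of\<close>)
      show ?left
        by (rule product_of_two_involutions_transpose
            [OF lower_mult_diag[OF cont_mat_transpose[OF Um] low one' inj sym]])
          (use c in \<open>auto simp: transpose_mult[of _ n n _ n] transpose_diag_of\<close>)
    qed
  qed
  then show ?right ?left by auto
qed

section \<open>Grouping unitriangular factors in pairs, and the final count\<close>

lemma unitriangular_pair:
  assumes U: "U \<in> cont_unitriangular X n" and V: "V \<in> cont_unitriangular X n"
  obtains A B C D where "{A, B, C, D} \<subseteq> cont_involutions X n"
    "\<And>x. x \<in> topspace X \<Longrightarrow> U x * V x = (A x * B x) * (C x * D x)"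
proof -
  \<comment> \<open>The exponents 2 i - (n - 1) are distinct and symmetric about 0, so the diagonal
    entries are distinct and reversal inverts them. Negative exponents require integer
    powers.\<close>
  define d :: "nat \<Rightarrow> complex" where "d i = 2 powi (2 * int i - int (n - 1))" for i
  define e where "e i = d (n - 1 - i)" for i
  have d0: "d i * e i = 1" if "i < n" for i
  proof -
    have "d i * e i = 2 powi ((2 * int i - int (n - 1)) + (2 * int (n - 1 - i) - int (n - 1)))"
      unfolding d_def e_def by (rule power_int_add[symmetric]) simp
    \<comment> \<open>The bound \<open>i < n\<close> makes the natural subtraction
      \<open>n - 1 - i\<close> exact.\<close>
    also have "(2 * int i - int (n - 1)) + (2 * int (n - 1 - i) - int (n - 1)) = 0"
      using that by auto
    finally show ?thesis by simp
  qed
  have inj: "inj_on d {..<n}"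
  proof (rule inj_onI)
    fix i j assume "d i = d j"
    \<comment> \<open>Norms turn the equation into one between real powers of 2, where strict
      monotonicity in the exponent applies.\<close>
    then have "norm (d i) = norm (d j)"
      by simp
    then have "(2::real) powi (2 * int i - int (n - 1)) = 2 powi (2 * int j - int (n - 1))"
      by (simp add: d_def norm_power_int)
    then have "2 * int i - int (n - 1) = 2 * int j - int (n - 1)"
      using power_int_strict_increasing[of _ _ "2::real"] by (metis linorder_cases less_irrefl one_less_numeral_iff semiring_norm(76))
    then show "i = j"
      by simp
  qed
  have inj': "inj_on e {..<n}"
  proof (rule inj_onI)
    fix i j assume ij: "i \<in> {..<n}" "j \<in> {..<n}" "e i = e j"
    then have "n - 1 - i = n - 1 - j"
      using inj_onD[OF inj] by (simp add: e_def)
    with ij show "i = j" by auto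
  qed
  have e0: "e i * e (n - 1 - i) = 1" if "i < n" for i
    using d0[OF that] that by (simp add: e_def mult.commute)
  obtain A B where A: "A \<in> cont_involutions X n" and B: "B \<in> cont_involutions X n"
    and AB: "\<And>x. x \<in> topspace X \<Longrightarrow> U x * diag_of n d = A x * B x"
    using unitriangular_diag(1)[OF U inj] d0 unfolding e_def product_of_two_involutions_def by blast
  obtain C D where C: "C \<in> cont_involutions X n" and D: "D \<in> cont_involutions X n"
    and CD: "\<And>x. x \<in> topspace X \<Longrightarrow> diag_of n e * V x = C x * D x"
    using unitriangular_diag(2)[OF V inj'] e0 unfolding product_of_two_involutions_def by blast
  show thesis
  proof (rule that)
    show "{A, B, C, D} \<subseteq> cont_involutions X n"
      using A B C D by simp
    fix x assume x: "x \<in> topspace X"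
    have c: "U x \<in> carrier_mat n n" "V x \<in> carrier_mat n n"
      using U V x by (auto simp: cont_unitriangular_def cont_mat_carrier)
    have "(U x * M) * (N * V x) = U x * (M * N) * V x"
      if "M \<in> carrier_mat n n" "N \<in> carrier_mat n n" for M N
      using c that by (simp add: assoc_mult_mat[of _ n n _ n _ n])
    \<comment> \<open>The inserted diagonal matrices are mutually inverse by \<open>d0\<close> and
      cancel between \<open>U x\<close> and \<open>V x\<close>.\<close>
    from this[OF diag_of_carrier diag_of_carrier, of d e] show "U x * V x = (A x * B x) * (C x * D x)"
      using c d0 by (simp add: diag_of_mult AB[OF x] CD[OF x])
  qed
qed

lemma foldr_mat_carrier:
  assumes "\<And>F. F \<in> set Fs \<Longrightarrow> F x \<in> carrier_mat n n"
  shows "foldr (*) (map (\<lambda>F. F x) Fs) (1\<^sub>m n) \<in> carrier_mat n n"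
  using assms by (induction Fs) (auto intro!: mult_carrier_mat)

text \<open>Induction removing two factors at a time, each pair costing four involutions. The number
  of pairs is half the length rounded up, as a last unpaired factor costs as much as a pair.\<close>

lemma unitriangular_product:
  assumes "set Fs \<subseteq> cont_unitriangular X n"
  shows "\<exists>Bs. length Bs = 4 * ((length Fs + 1) div 2) \<and> set Bs \<subseteq> cont_involutions X n \<and>
    (\<forall>x\<in>topspace X. foldr (*) (map (\<lambda>F. F x) Fs) (1\<^sub>m n) = foldr (*) (map (\<lambda>F. F x) Bs) (1\<^sub>m n))"
  using assms
proof (induction Fs rule: induct_list012)
  case 1
  then show ?case by simp
next
  case (2 U)
  \<comment> \<open>The identity is unitriangular and serves as partner of the single remaining
    factor.\<close>
  have one: "(\<lambda>x. 1\<^sub>m n) \<in> cont_unitriangular X n"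
    by (auto simp: cont_unitriangular_def cont_mat_const upper_triangular_def)
  obtain A B C D where inv: "{A, B, C, D} \<subseteq> cont_involutions X n"
    and eq: "\<And>x. x \<in> topspace X \<Longrightarrow> U x * 1\<^sub>m n = (A x * B x) * (C x * D x)"
    using unitriangular_pair[OF _ one, of U] 2 by (metis list.set_intros(1) subsetD)
  have "U x * 1\<^sub>m n = A x * (B x * (C x * (D x * 1\<^sub>m n)))" if x: "x \<in> topspace X" for x
  proof -
    have "A x \<in> carrier_mat n n" "B x \<in> carrier_mat n n" "C x \<in> carrier_mat n n" "D x \<in> carrier_mat n n"
      using inv x by (auto simp: cont_involutions_iff cont_mat_carrier)
    then show ?thesis
      using eq[OF x] by (simp add: assoc_mult_mat[of _ n n _ n _ n])
  qed
  then show ?case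
    using inv by (intro exI[of _ "[A, B, C, D]"]) simp
next
  case (3 U V Fs)
  then obtain Bs where Bs: "length Bs = 4 * ((length Fs + 1) div 2)" "set Bs \<subseteq> cont_involutions X n"
    "\<And>x. x \<in> topspace X \<Longrightarrow>
      foldr (*) (map (\<lambda>F. F x) Fs) (1\<^sub>m n) = foldr (*) (map (\<lambda>F. F x) Bs) (1\<^sub>m n)"
    by auto
  obtain A B C D where inv: "{A, B, C, D} \<subseteq> cont_involutions X n"
    and eq: "\<And>x. x \<in> topspace X \<Longrightarrow> U x * V x = (A x * B x) * (C x * D x)"
    using unitriangular_pair[of U X n V] 3(3) by (metis list.set_intros insert_subset list.simps(15))
  \<comment> \<open>\<open>R\<close> stands for the product of the remaining factors; the bracketing
    is the one produced by \<open>foldr\<close>.\<close>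
  have "U x * (V x * R) = A x * (B x * (C x * (D x * R)))"
    if x: "x \<in> topspace X" and R: "R \<in> carrier_mat n n" for x R
  proof -
    have c: "A x \<in> carrier_mat n n" "B x \<in> carrier_mat n n" "C x \<in> carrier_mat n n" "D x \<in> carrier_mat n n"
      using inv x by (auto simp: cont_involutions_iff cont_mat_carrier)
    have "U x \<in> carrier_mat n n" "V x \<in> carrier_mat n n"
      using "3.prems" x by (auto simp: cont_unitriangular_def cont_mat_carrier)
    then have "U x * (V x * R) = (U x * V x) * R"
      using R by (simp add: assoc_mult_mat[of _ n n _ n _ n])
    also have "\<dots> = A x * (B x * (C x * (D x * R)))"
      unfolding eq[OF x] using R c by (simp add: assoc_mult_mat[of _ n n _ n _ n])
    finally show ?thesis .
  qed
  moreover have "foldr (*) (map (\<lambda>F. F x) Bs) (1\<^sub>m n) \<in> carrier_mat n n" if "x \<in> topspace X" for x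
    using Bs(2) that
    by (intro foldr_mat_carrier) (meson cont_involutions_iff cont_mat_carrier subsetD)
  ultimately show ?case
    using inv Bs by (intro exI[of _ "A # B # C # D # Bs"]) simp
qed

theorem corollary3p3:
  fixes n d L :: nat
  assumes "n \<ge> 1"
    and "\<forall>(T :: 'a topology) f.
           normal_space T \<and> has_covering_dim T d \<and>
           continuous_map T (SL_topology n) f \<and> null_homotopic_SL T n f \<longrightarrow>
           is_product_of_at_most T n L (cont_unitriangular T n) f"
  shows "\<forall>(T :: 'a topology) f.
           normal_space T \<and> has_covering_dim T d \<and>
           continuous_map T (SL_topology n) f \<and> null_homotopic_SL T n f \<longrightarrow>
           is_product_of_at_most T n (4 * (L div 2 + 1)) (cont_involutions T n) f"
proof (intro allI impI)
  fix T :: "'a topology" and f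
  assume "normal_space T \<and> has_covering_dim T d \<and>
    continuous_map T (SL_topology n) f \<and> null_homotopic_SL T n f"
  then have "is_product_of_at_most T n L (cont_unitriangular T n) f"
    using assms(2) by blast
  then obtain Fs where Fs: "length Fs \<le> L" "set Fs \<subseteq> cont_unitriangular T n"
    "\<forall>x\<in>topspace T. f x = foldr (*) (map (\<lambda>F. F x) Fs) (1\<^sub>m n)"
    unfolding is_product_of_at_most_def by blast
  obtain Bs where Bs: "length Bs = 4 * ((length Fs + 1) div 2)" "set Bs \<subseteq> cont_involutions T n"
    "\<forall>x\<in>topspace T.
      foldr (*) (map (\<lambda>F. F x) Fs) (1\<^sub>m n) = foldr (*) (map (\<lambda>F. F x) Bs) (1\<^sub>m n)"
    using unitriangular_product[OF Fs(2)] by blast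
  \<comment> \<open>Rounding up is absorbed by the extra 1: \<open>length Fs + 1\<close> is at most
    \<open>L + 2\<close>, and \<open>(L + 2) div 2\<close> equals
    \<open>L div 2 + 1\<close>.\<close>
  have "length Bs \<le> 4 * (L div 2 + 1)"
    unfolding Bs(1) using Fs(1) div_le_mono[of "length Fs + 1" "L + 2" 2] by simp
  then show "is_product_of_at_most T n (4 * (L div 2 + 1)) (cont_involutions T n) f"
    unfolding is_product_of_at_most_def using Bs(2,3) Fs(3) by (intro exI[of _ Bs]) simp
qed

end
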